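(* The cardinality $G\mapsto \#G$ is (a) an $(\mathbb N_\infty,\cdot)$-valued dimension on the category $\mathrm{Grp}$ of groups and group homomorphisms, and (b) an $(\mathbb N,\cdot)$-valued dimension on the category $\mathrm{FinGrp}$ of finite groups and group homomorphisms.
   Context: $\mathbb N=\{0,1,2,\dots\}$ and $\mathbb N_\infty=\mathbb N\cup\{\infty\}$. The monoid $(\mathbb N_\infty,\cdot)$ has neutral element $1$, extends the usual multiplication, and satisfies $a\cdot\infty=\infty\cdot a=\infty$ for all $a$ (in particular $0\cdot\infty=\infty$). $\#G\in\mathbb N_\infty$ is the number of elements of $G$, and $\infty$ whenever $G$ is infinite. $M$-valued dimension. Let $M$ be a commutative monoid, written additively, and $\mathbb X$ a category; $\pi_0(\mathbb X)$ denotes the collection of isomorphism classes of objects of $\mathbb X$. An $M$-valued dimension on $\mathbb X$ is a function $\dim:\pi_0(\mathbb X)\to M$ such that for every pullback $A\times_B C$ in $\mathbb X$ of a morphism $f:C\to B$ along a retraction (split epimorphism) $r:A\to B$, if $f$ is a retraction or $f$ is a section (split monomorphism), then $\dim(A\times_B C)+\dim(B)=\dim(A)+\dim(C)$. For the monoids above, the operation "$+$" in this definition is multiplication, so the condition reads $\#(A\times_B C)\cdot\#B=\#A\cdot\#C$. *)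

theory Defs
  imports "HOL-Algebra.Coset" "HOL-Library.Extended_Nat" "HOL-Library.FuncSet"
begin

section \<open>Categories\<close>

text \<open>
  Hom-sets of different pairs of objects need not be disjoint, so composition takes the three
  objects as arguments: \<open>Comp X A B C g f\<close> is the composite of \<open>f : A \<rightarrow> B\<close> and \<open>g : B \<rightarrow> C\<close>.
\<close>

record ('o, 'm) category_data =
  Ob :: "'o set"
  Hom :: "'o \<Rightarrow> 'o \<Rightarrow> 'm set"
  Ident :: "'o \<Rightarrow> 'm"
  Comp :: "'o \<Rightarrow> 'o \<Rightarrow> 'o \<Rightarrow> 'm \<Rightarrow> 'm \<Rightarrow> 'm"

locale category =
  fixes X :: "('o, 'm) category_data"
  assumes Ident_in_Hom: "A \<in> Ob X \<Longrightarrow> Ident X A \<in> Hom X A A"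
    and Comp_in_Hom:
      "\<lbrakk>A \<in> Ob X; B \<in> Ob X; C \<in> Ob X; f \<in> Hom X A B; g \<in> Hom X B C\<rbrakk>
        \<Longrightarrow> Comp X A B C g f \<in> Hom X A C"
    and Comp_Ident_right:
      "\<lbrakk>A \<in> Ob X; B \<in> Ob X; f \<in> Hom X A B\<rbrakk> \<Longrightarrow> Comp X A A B f (Ident X A) = f"
    and Comp_Ident_left:
      "\<lbrakk>A \<in> Ob X; B \<in> Ob X; f \<in> Hom X A B\<rbrakk> \<Longrightarrow> Comp X A B B (Ident X B) f = f"
    and Comp_assoc:
      "\<lbrakk>A \<in> Ob X; B \<in> Ob X; C \<in> Ob X; D \<in> Ob X;
        f \<in> Hom X A B; g \<in> Hom X B C; h \<in> Hom X C D\<rbrakk>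
        \<Longrightarrow> Comp X A B D (Comp X B C D h g) f = Comp X A C D h (Comp X A B C g f)"

definition is_retraction :: "('o, 'm) category_data \<Rightarrow> 'o \<Rightarrow> 'o \<Rightarrow> 'm \<Rightarrow> bool" where
  "is_retraction X A B r \<longleftrightarrow>
     r \<in> Hom X A B \<and> (\<exists>s \<in> Hom X B A. Comp X B A B r s = Ident X B)"

definition is_section :: "('o, 'm) category_data \<Rightarrow> 'o \<Rightarrow> 'o \<Rightarrow> 'm \<Rightarrow> bool" where
  "is_section X A B s \<longleftrightarrow>
     s \<in> Hom X A B \<and> (\<exists>r \<in> Hom X B A. Comp X A B A r s = Ident X A)"

definition iso_rel :: "('o, 'm) category_data \<Rightarrow> ('o \<times> 'o) set" where
  "iso_rel X = {(A, B). A \<in> Ob X \<and> B \<in> Ob X \<and>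
     (\<exists>f \<in> Hom X A B. \<exists>g \<in> Hom X B A.
        Comp X A B A g f = Ident X A \<and> Comp X B A B f g = Ident X B)}"

definition iso_class :: "('o, 'm) category_data \<Rightarrow> 'o \<Rightarrow> 'o set" where
  "iso_class X A = iso_rel X `` {A}"

definition pi0 :: "('o, 'm) category_data \<Rightarrow> 'o set set" where
  "pi0 X = Ob X // iso_rel X"

text \<open>
  \<open>is_pullback X A B C r f P p q\<close>: the object \<open>P\<close> with projections \<open>p : P \<rightarrow> A\<close> and \<open>q : P \<rightarrow> C\<close>
  is a pullback of \<open>f : C \<rightarrow> B\<close> along \<open>r : A \<rightarrow> B\<close>.
\<close>

definition is_pullback ::
  "('o, 'm) category_data \<Rightarrow> 'o \<Rightarrow> 'o \<Rightarrow> 'o \<Rightarrow> 'm \<Rightarrow> 'm \<Rightarrow> 'o \<Rightarrow> 'm \<Rightarrow> 'm \<Rightarrow> bool" where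
  "is_pullback X A B C r f P p q \<longleftrightarrow>
     A \<in> Ob X \<and> B \<in> Ob X \<and> C \<in> Ob X \<and> P \<in> Ob X \<and>
     r \<in> Hom X A B \<and> f \<in> Hom X C B \<and> p \<in> Hom X P A \<and> q \<in> Hom X P C \<and>
     Comp X P A B r p = Comp X P C B f q \<and>
     (\<forall>Q \<in> Ob X. \<forall>u \<in> Hom X Q A. \<forall>v \<in> Hom X Q C.
        Comp X Q A B r u = Comp X Q C B f v \<longrightarrow>
        (\<exists>!h. h \<in> Hom X Q P \<and> Comp X Q P A p h = u \<and> Comp X Q P C q h = v))"

locale monoid_valued_dimension = category X + comm_monoid M
  for X :: "('o, 'm) category_data" and M :: "'v monoid" +
  fixes dim :: "'o set \<Rightarrow> 'v"
  assumes dim_closed: "dim \<in> pi0 X \<rightarrow> carrier M"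
    and dim_pullback:
      "\<lbrakk>is_pullback X A B C r f P p q; is_retraction X A B r;
        is_retraction X C B f \<or> is_section X C B f\<rbrakk>
        \<Longrightarrow> dim (iso_class X P) \<otimes>\<^bsub>M\<^esub> dim (iso_class X B)
            = dim (iso_class X A) \<otimes>\<^bsub>M\<^esub> dim (iso_class X C)"


section \<open>Groups and finite groups\<close>

text \<open>
  The type \<open>'u\<close> plays the role of the universe: the objects are all groups whose carrier is a
  subset of \<open>'u\<close>. Homomorphisms are made extensional outside the carrier of their domain, so that
  equality of morphisms is equality of homomorphisms. For infinite \<open>'u\<close> the universe is closed under
  binary products up to isomorphism, so pullbacks in \<open>Grp\<close> and \<open>FinGrp\<close> exist and are the usual
  fibre products of groups; over a finite \<open>'u\<close> they need not exist.
\<close>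

definition Grp :: "('u monoid, 'u \<Rightarrow> 'u) category_data" where
  "Grp = \<lparr>Ob = {G. group G},
          Hom = (\<lambda>G H. hom G H \<inter> extensional (carrier G)),
          Ident = (\<lambda>G. \<lambda>x \<in> carrier G. x),
          Comp = (\<lambda>G H K g f. compose (carrier G) g f)\<rparr>"

definition FinGrp :: "('u monoid, 'u \<Rightarrow> 'u) category_data" where
  "FinGrp = Grp\<lparr>Ob := {G. group G \<and> finite (carrier G)}\<rparr>"


section \<open>Multiplicative monoids and cardinality\<close>

definition mult_nat :: "nat monoid" where
  "mult_nat = \<lparr>carrier = UNIV, mult = (*), one = 1\<rparr>"

text \<open>
  The library product on \<^typ>\<open>enat\<close> satisfies \<open>0 * \<infinity> = 0\<close>, whereas here \<open>0 \<cdot> \<infinity> = \<infinity>\<close>.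
\<close>

definition mult_enat :: "enat monoid" where
  "mult_enat = \<lparr>carrier = UNIV,
                mult = (\<lambda>a b. if a = \<infinity> \<or> b = \<infinity> then \<infinity> else a * b),
                one = 1\<rparr>"

definition group_card :: "'u monoid \<Rightarrow> enat" where
  "group_card G = (if finite (carrier G) then enat (order G) else \<infinity>)"

end

theory Submission
  imports Defs "HOL-Algebra.Weak_Morphisms"
begin

text \<open>
  For a split epimorphism \<open>r : A \<rightarrow> B\<close> with section \<open>s\<close> and any \<open>f : C \<rightarrow> B\<close>, the map
  \<open>((a, c), b) \<mapsto> (a \<cdot> s (f c)\<^sup>-\<^sup>1 \<cdot> s b, c)\<close> is a bijection from \<open>(A \<times>\<^sub>B C) \<times> B\<close> onto \<open>A \<times> C\<close>: it moves
  \<open>a\<close> from the fibre of \<open>r\<close> over \<open>f c\<close> to the fibre over \<open>b\<close>. A categorical pullback in the given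
  universe is in bijection with the usual fibre product because the latter, transported along an
  injection \<open>'u \<times> 'u \<rightarrow> 'u\<close>, is an object of the category and can be used to test the universal property.
\<close>

section \<open>Fibre products of groups and the counting bijection\<close>

definition fibre_product :: "'a monoid \<Rightarrow> 'c monoid \<Rightarrow> ('a \<Rightarrow> 'b) \<Rightarrow> ('c \<Rightarrow> 'b) \<Rightarrow> ('a \<times> 'c) set" where
  "fibre_product A C r f = {(a, c). a \<in> carrier A \<and> c \<in> carrier C \<and> r a = f c}"

lemma subgroup_fibre_product:
  assumes "group A" "group B" "group C" and r: "r \<in> hom A B" and f: "f \<in> hom C B"
  shows "subgroup (fibre_product A C r f) (A \<times>\<times> C)"
proof -
  interpret A: group A by fact
  interpret C: group C by fact
  interpret AC: group "A \<times>\<times> C" by (rule DirProd_group) fact+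
  interpret r: group_hom A B r using assms by (simp add: group_hom_def group_hom_axioms_def)
  interpret f: group_hom C B f using assms by (simp add: group_hom_def group_hom_axioms_def)
  have "(\<one>\<^bsub>A\<^esub>, \<one>\<^bsub>C\<^esub>) \<in> fibre_product A C r f"
    by (simp add: fibre_product_def)
  then have "fibre_product A C r f \<noteq> {}" by blast
  then show ?thesis
    by (rule AC.subgroupI[rotated]) (auto simp: fibre_product_def inv_DirProd[OF assms(1,3)])
qed

lemma bij_betw_fibre_product_Times:
  assumes "group A" "group B" "group C"
    and r: "r \<in> hom A B" and s: "s \<in> hom B A" and rs: "\<And>b. b \<in> carrier B \<Longrightarrow> r (s b) = b"
    and f: "f \<in> hom C B"
  shows "bij_betw (\<lambda>((a, c), b). (a \<otimes>\<^bsub>A\<^esub> inv\<^bsub>A\<^esub> s (f c) \<otimes>\<^bsub>A\<^esub> s b, c))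
           (fibre_product A C r f \<times> carrier B) (carrier A \<times> carrier C)"
proof -
  interpret A: group A by fact
  interpret B: group B by fact
  interpret C: group C by fact
  interpret r: group_hom A B r using assms by (simp add: group_hom_def group_hom_axioms_def)
  interpret s: group_hom B A s using assms by (simp add: group_hom_def group_hom_axioms_def)
  interpret f: group_hom C B f using assms by (simp add: group_hom_def group_hom_axioms_def)
  \<comment> \<open>Both round trips of the bijection reduce to this identity: one with
    \<open>y = s (f c)\<close>, \<open>z = s b\<close>, the other with \<open>y = s (r a)\<close>,
    \<open>z = s (f c)\<close>.\<close>
  have cancel: "x \<otimes>\<^bsub>A\<^esub> inv\<^bsub>A\<^esub> y \<otimes>\<^bsub>A\<^esub> z \<otimes>\<^bsub>A\<^esub> inv\<^bsub>A\<^esub> z \<otimes>\<^bsub>A\<^esub> y = x"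
    if "x \<in> carrier A" "y \<in> carrier A" "z \<in> carrier A" for x y z
    using that by (simp add: A.m_assoc)
  show ?thesis
    \<comment> \<open>The inverse reads \<open>b\<close> off as the image of the first component
      under \<open>r\<close>: if \<open>r a = f c\<close>, then \<open>r\<close> sends
      \<open>a\<close> times the inverse of \<open>s (f c)\<close> times \<open>s b\<close> to
      \<open>b\<close>. It then moves that component back to the fibre over
      \<open>f c\<close>.\<close>
    by (rule bij_betw_byWitness[where
          f' = "\<lambda>(a, c). ((a \<otimes>\<^bsub>A\<^esub> inv\<^bsub>A\<^esub> s (r a) \<otimes>\<^bsub>A\<^esub> s (f c), c), r a)"])
      (auto simp: fibre_product_def rs cancel)
qed

section \<open>Full subcategories of groups: pullbacks and dimensions\<close>

lemma Grp_simps [simp]: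
  "Ob Grp = Collect group"
  "Hom Grp G H = hom G H \<inter> extensional (carrier G)"
  "Ident Grp G = (\<lambda>x \<in> carrier G. x)"
  "Comp Grp G H K g f = compose (carrier G) g f"
  by (simp_all add: Grp_def)

text \<open>Replacing only \<open>Ob\<close> gives the full subcategory on \<open>S\<close>, so
  \<open>Grp\<close> and \<open>FinGrp\<close> can be treated together.\<close>

lemma category_Grp_Ob_update:
  fixes S :: "'u monoid set"
  assumes "S \<subseteq> Collect group"
  shows "category (Grp\<lparr>Ob := S\<rparr>)"
proof unfold_locales
  fix A B C and f g :: "'u \<Rightarrow> 'u"
  assume "A \<in> Ob (Grp\<lparr>Ob := S\<rparr>)" "f \<in> Hom (Grp\<lparr>Ob := S\<rparr>) A B" "g \<in> Hom (Grp\<lparr>Ob := S\<rparr>) B C"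
  then show "Comp (Grp\<lparr>Ob := S\<rparr>) A B C g f \<in> Hom (Grp\<lparr>Ob := S\<rparr>) A C"
    using assms by (auto intro: group.hom_compose)
next
  fix A assume "A \<in> Ob (Grp\<lparr>Ob := S\<rparr>)"
  then have "group A" using assms by auto
  then show "Ident (Grp\<lparr>Ob := S\<rparr>) A \<in> Hom (Grp\<lparr>Ob := S\<rparr>) A A"
    by (auto simp: hom_def group.is_monoid monoid.m_closed)
next
  fix A B C D and f g h :: "'u \<Rightarrow> 'u"
  assume "f \<in> Hom (Grp\<lparr>Ob := S\<rparr>) A B"
  \<comment> \<open>Composites are \<open>undefined\<close> off the carrier of their domain, so
    associativity needs \<open>f\<close> to land in the carrier of \<open>B\<close>, the domain of
    \<open>g\<close>.\<close>
  then have "f \<in> carrier A \<rightarrow> carrier B" by (auto simp: hom_def)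
  then show "Comp (Grp\<lparr>Ob := S\<rparr>) A B D (Comp (Grp\<lparr>Ob := S\<rparr>) B C D h g) f
      = Comp (Grp\<lparr>Ob := S\<rparr>) A C D h (Comp (Grp\<lparr>Ob := S\<rparr>) A B C g f)"
    by (auto simp: compose_def fun_eq_iff)
qed (auto simp: compose_def hom_def extensional_def fun_eq_iff)

lemma compose_eqD: "compose A g f = h \<Longrightarrow> x \<in> A \<Longrightarrow> g (f x) = h x"
  by (auto simp: compose_def)

text \<open>Existence of a mediating map from the encoded fibre product makes \<open>(p, q)\<close>
  surjective, and uniqueness for the cone \<open>(p, q)\<close> itself makes it injective. The
  hypothesis \<open>closed\<close> ensures that the encoded group is a legitimate test
  object.\<close>

lemma is_pullback_bij_fibre_product:
  fixes S :: "'u monoid set"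
  assumes inf: "infinite (UNIV :: 'u set)"
    and S: "S \<subseteq> Collect group"
    and closed: "\<And>G A C (e :: 'u \<times> 'u \<Rightarrow> 'u). A \<in> S \<Longrightarrow> C \<in> S \<Longrightarrow> group G \<Longrightarrow>
      carrier G \<subseteq> e ` (carrier A \<times> carrier C) \<Longrightarrow> G \<in> S"
    and pb: "is_pullback (Grp\<lparr>Ob := S\<rparr>) A B C r f P p q"
  shows "bij_betw (\<lambda>x. (p x, q x)) (carrier P) (fibre_product A C r f)"
proof -
  have obs: "A \<in> S" "C \<in> S" "P \<in> S"
    and groups: "group A" "group B" "group C" "group P"
    and homs: "r \<in> hom A B" "f \<in> hom C B" "p \<in> hom P A" "q \<in> hom P C"
    and extn: "p \<in> extensional (carrier P)" "q \<in> extensional (carrier P)"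
    and comm: "compose (carrier P) r p = compose (carrier P) f q"
    and univ: "\<And>Q u v. \<lbrakk>Q \<in> S; u \<in> hom Q A \<inter> extensional (carrier Q);
        v \<in> hom Q C \<inter> extensional (carrier Q);
        compose (carrier Q) r u = compose (carrier Q) f v\<rbrakk> \<Longrightarrow>
        \<exists>!h. h \<in> hom Q P \<inter> extensional (carrier Q) \<and>
          compose (carrier Q) p h = u \<and> compose (carrier Q) q h = v"
    using pb S unfolding is_pullback_def by auto
  let ?F = "fibre_product A C r f"
  \<comment> \<open>An infinite set is equinumerous with its square; \<open>e\<close> encodes pairs
    as elements of the universe and \<open>d\<close> decodes them.\<close>
  obtain e :: "'u \<times> 'u \<Rightarrow> 'u" where e: "inj e"
    using card_of_Times_same_infinite[OF inf] unfolding card_of_ordIso[symmetric]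
    by (auto simp: bij_betw_def)
  obtain d where d [simp]: "d (e x) = x" for x
    using inv_f_f[OF e] by blast
  \<comment> \<open>\<open>K\<close> is the fibre product as a subgroup of the direct product;
    \<open>Q\<close> is its isomorphic copy inside \<open>'u\<close>, and \<open>u\<close>,
    \<open>v\<close> below are the projections read through \<open>d\<close>.\<close>
  define K where "K = (A \<times>\<times> C)\<lparr>carrier := ?F\<rparr>"
  define Q where "Q = image_group e K"
  interpret K: group K
    unfolding K_def
    by (rule subgroup.subgroup_is_group[OF subgroup_fibre_product[OF groups(1-3) homs(1,2)]
          DirProd_group[OF groups(1,3)]])
  have inv_into_e [simp]: "inv_into ?F e (e y) = y" if "y \<in> ?F" for y
    using inv_into_f_f[OF inj_on_subset[OF e subset_UNIV] that] .
  have cQ: "carrier Q = e ` ?F"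
    by (simp add: Q_def image_group_carrier K_def)
  have mQ: "e x \<otimes>\<^bsub>Q\<^esub> e y = e (fst x \<otimes>\<^bsub>A\<^esub> fst y, snd x \<otimes>\<^bsub>C\<^esub> snd y)" if "x \<in> ?F" "y \<in> ?F" for x y
    using that by (simp add: Q_def image_group_def K_def DirProd_def split: prod.split)
  have "group Q"
    unfolding Q_def by (rule K.inj_imp_image_group_is_group[OF inj_on_subset[OF e subset_UNIV]])
  moreover have "?F \<subseteq> carrier A \<times> carrier C" by (auto simp: fibre_product_def)
  ultimately have QS: "Q \<in> S"
    using closed[OF obs(1,2), of Q e] by (auto simp: cQ)
  define u where "u = (\<lambda>x \<in> carrier Q. fst (d x))"
  define v where "v = (\<lambda>x \<in> carrier Q. snd (d x))"
  have mQ_closed: "x \<in> carrier Q \<Longrightarrow> y \<in> carrier Q \<Longrightarrow> x \<otimes>\<^bsub>Q\<^esub> y \<in> carrier Q" for x y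
    using \<open>group Q\<close> by (simp add: group.is_monoid monoid.m_closed)
  have d_closed: "d x \<in> ?F" if "x \<in> carrier Q" for x
    using that by (auto simp: cQ)
  have d_mult: "d (x \<otimes>\<^bsub>Q\<^esub> y) = (fst (d x) \<otimes>\<^bsub>A\<^esub> fst (d y), snd (d x) \<otimes>\<^bsub>C\<^esub> snd (d y))"
    if "x \<in> carrier Q" "y \<in> carrier Q" for x y
    using that by (auto simp: cQ mQ)
  have u: "u \<in> hom Q A \<inter> extensional (carrier Q)" and v: "v \<in> hom Q C \<inter> extensional (carrier Q)"
    using mQ_closed d_closed
    by (auto simp: u_def v_def hom_def d_mult fibre_product_def split_beta)
  have "compose (carrier Q) r u = compose (carrier Q) f v"
    by (rule ext) (auto simp: compose_def cQ u_def v_def fibre_product_def)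
  from univ[OF QS u v this] obtain h where h: "h \<in> hom Q P"
    and ph: "compose (carrier Q) p h = u" and qh: "compose (carrier Q) q h = v"
    by auto
  have pq: "(p x, q x) \<in> ?F" if "x \<in> carrier P" for x
    using that homs compose_eqD[OF comm that] by (auto simp: fibre_product_def hom_def compose_def)
  have h_closed: "h (e y) \<in> carrier P" and pqh: "p (h (e y)) = fst y" "q (h (e y)) = snd y"
    if "y \<in> ?F" for y
    using h that compose_eqD[OF ph, of "e y"] compose_eqD[OF qh, of "e y"]
    by (auto simp: cQ u_def v_def hom_def)
  \<comment> \<open>\<open>k\<close> is the loop from \<open>P\<close> to the fibre product, to
    \<open>Q\<close>, and back by \<open>h\<close>. Both \<open>k\<close> and the identity mediate
    the cone \<open>(p, q)\<close> on \<open>P\<close>, hence they agree.\<close>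
  define k where "k = (\<lambda>x \<in> carrier P. h (e (p x, q x)))"
  have "k \<in> hom P P"
  proof (rule homI)
    fix x y assume xy: "x \<in> carrier P" "y \<in> carrier P"
    have "e (p (x \<otimes>\<^bsub>P\<^esub> y), q (x \<otimes>\<^bsub>P\<^esub> y)) = e (p x, q x) \<otimes>\<^bsub>Q\<^esub> e (p y, q y)"
      using xy homs by (simp add: mQ pq hom_mult)
    then show "k (x \<otimes>\<^bsub>P\<^esub> y) = k x \<otimes>\<^bsub>P\<^esub> k y"
      using xy h groups(4) by (simp add: k_def cQ pq hom_mult group.is_monoid monoid.m_closed)
  qed (simp add: k_def h_closed pq)
  moreover have "(\<lambda>x \<in> carrier P. x) \<in> hom P P"
    using groups(4) by (auto simp: hom_def group.is_monoid monoid.m_closed)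
  moreover have "k \<in> extensional (carrier P)" by (simp add: k_def)
  moreover have "compose (carrier P) p k = p" "compose (carrier P) q k = q"
    "compose (carrier P) p (\<lambda>x \<in> carrier P. x) = p" "compose (carrier P) q (\<lambda>x \<in> carrier P. x) = q"
    using extn by (auto simp: fun_eq_iff compose_def k_def pqh pq extensional_def)
  ultimately have k: "k = (\<lambda>x \<in> carrier P. x)"
    using univ[OF obs(3) _ _ comm] homs extn by (metis IntI restrict_extensional)
  have "h (e (p x, q x)) = x" if "x \<in> carrier P" for x
    using fun_cong[OF k, of x] that by (simp add: k_def)
  then show ?thesis
    by (intro bij_betw_byWitness[where f' = "\<lambda>y. h (e y)"]) (auto simp: pq pqh h_closed)
qed

text \<open>Common core of both claims: any \<open>\<phi>\<close> that depends only on the size of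
  the carrier and turns the counting bijection into an equation in \<open>M\<close> descends to a
  dimension.\<close>

lemma monoid_valued_dimension_Grp_Ob_update:
  fixes S :: "'u monoid set" and M :: "'v monoid" and \<phi> :: "'u monoid \<Rightarrow> 'v"
  assumes inf: "infinite (UNIV :: 'u set)"
    and S: "S \<subseteq> Collect group"
    and closed: "\<And>G A C (e :: 'u \<times> 'u \<Rightarrow> 'u). A \<in> S \<Longrightarrow> C \<in> S \<Longrightarrow> group G \<Longrightarrow>
      carrier G \<subseteq> e ` (carrier A \<times> carrier C) \<Longrightarrow> G \<in> S"
    and M: "comm_monoid M" "carrier M = UNIV"
    and bij: "\<And>G H k. bij_betw k (carrier G) (carrier H) \<Longrightarrow> \<phi> G = \<phi> H"
    and mult: "\<And>A B C P k. \<lbrakk>A \<in> S; B \<in> S; C \<in> S; P \<in> S;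
      bij_betw k (carrier P \<times> carrier B) (carrier A \<times> carrier C)\<rbrakk>
      \<Longrightarrow> \<phi> P \<otimes>\<^bsub>M\<^esub> \<phi> B = \<phi> A \<otimes>\<^bsub>M\<^esub> \<phi> C"
  shows "\<exists>dim. monoid_valued_dimension (Grp\<lparr>Ob := S\<rparr>) M dim \<and>
    (\<forall>G \<in> S. dim (iso_class (Grp\<lparr>Ob := S\<rparr>) G) = \<phi> G)"
proof -
  let ?X = "Grp\<lparr>Ob := S\<rparr>"
  interpret category ?X using S by (rule category_Grp_Ob_update)
  interpret M: comm_monoid M by fact
  \<comment> \<open>The value on a class is taken at a chosen representative; isomorphic groups have
    carriers in bijection, so the choice does not affect \<open>\<phi>\<close>.\<close>
  define dim where "dim c = \<phi> (SOME G. G \<in> c)" for c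
  have dim: "dim (iso_class ?X G) = \<phi> G" if G: "G \<in> S" for G
  proof -
    have "G \<in> iso_class ?X G"
      using G Ident_in_Hom[of G] Comp_Ident_left[of G G "Ident ?X G"]
      by (auto simp: iso_class_def iso_rel_def)
    then have "(SOME H. H \<in> iso_class ?X G) \<in> iso_class ?X G" (is "?H \<in> _")
      by (rule someI)
    then obtain i j where "i \<in> hom G ?H" "j \<in> hom ?H G"
      and ji: "compose (carrier G) j i = (\<lambda>x \<in> carrier G. x)"
      and ij: "compose (carrier ?H) i j = (\<lambda>x \<in> carrier ?H. x)"
      by (auto simp: iso_class_def iso_rel_def)
    then have "bij_betw i (carrier G) (carrier ?H)"
      by (intro bij_betw_byWitness[where f' = j])
        (auto simp: hom_def compose_eqD[OF ji] compose_eqD[OF ij])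
    from bij[OF this] show ?thesis by (simp add: dim_def)
  qed
  have "monoid_valued_dimension ?X M dim"
  proof unfold_locales
    show "dim \<in> pi0 ?X \<rightarrow> carrier M" by (simp add: M)
  next
    fix A B C r f P p q
    assume pb: "is_pullback ?X A B C r f P p q" and "is_retraction ?X A B r"
    then obtain s where s: "s \<in> hom B A" and rs: "compose (carrier B) r s = (\<lambda>x \<in> carrier B. x)"
      by (auto simp: is_retraction_def)
    have obs: "A \<in> S" "B \<in> S" "C \<in> S" "P \<in> S" and "r \<in> hom A B" "f \<in> hom C B"
      using pb by (auto simp: is_pullback_def)
    moreover have "r (s b) = b" if "b \<in> carrier B" for b
      using compose_eqD[OF rs that] that by simp
    ultimately have fp: "bij_betw (\<lambda>((a, c), b). (a \<otimes>\<^bsub>A\<^esub> inv\<^bsub>A\<^esub> s (f c) \<otimes>\<^bsub>A\<^esub> s b, c))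
        (fibre_product A C r f \<times> carrier B) (carrier A \<times> carrier C)"
      using S s by (intro bij_betw_fibre_product_Times) auto
    \<comment> \<open>Replacing \<open>P\<close> by the fibre product and then applying
      \<open>fp\<close> gives a bijection from \<open>P\<close> times \<open>B\<close> onto
      \<open>A\<close> times \<open>C\<close>.\<close>
    have "bij_betw (map_prod (\<lambda>x. (p x, q x)) id) (carrier P \<times> carrier B)
        (fibre_product A C r f \<times> carrier B)"
      by (intro bij_betw_map_prod is_pullback_bij_fibre_product[OF inf S closed pb]) auto
    from mult[OF obs bij_betw_trans[OF this fp]]
    show "dim (iso_class ?X P) \<otimes>\<^bsub>M\<^esub> dim (iso_class ?X B)
        = dim (iso_class ?X A) \<otimes>\<^bsub>M\<^esub> dim (iso_class ?X C)"
      using obs by (simp add: dim)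
  qed
  with dim show ?thesis by blast
qed

section \<open>Cardinalities in the multiplicative monoids\<close>

lemma comm_monoid_mult_nat: "comm_monoid mult_nat"
  by (rule comm_monoidI) (auto simp: mult_nat_def)

lemma carrier_mult_enat: "carrier mult_enat = UNIV"
  by (simp add: mult_enat_def)

lemma comm_monoid_mult_enat: "comm_monoid mult_enat"
  by (rule comm_monoidI)
    (auto simp: mult_enat_def ac_simps one_enat_def split: enat.splits)

lemma group_card_eq_of_bij_betw:
  "bij_betw k (carrier G) (carrier H) \<Longrightarrow> group_card G = group_card H"
  by (simp add: group_card_def order_def bij_betw_finite bij_betw_same_card)

lemma group_card_mult:
  assumes "group G" "group H"
  shows "group_card G \<otimes>\<^bsub>mult_enat\<^esub> group_card H
    = (if finite (carrier G \<times> carrier H) then enat (card (carrier G \<times> carrier H)) else \<infinity>)"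
  \<comment> \<open>The neutral elements show that both carriers are nonempty. An empty factor would
    make the product finite even when the other factor is infinite.\<close>
  using group.is_monoid[OF assms(1), THEN monoid.one_closed]
    group.is_monoid[OF assms(2), THEN monoid.one_closed]
  by (auto simp: mult_enat_def group_card_def order_def finite_cartesian_product_iff
      card_cartesian_product)

theorem theorem5p2:
  assumes "infinite (UNIV :: 'u set)"
  shows "(\<exists>dim. monoid_valued_dimension (Grp :: ('u monoid, 'u \<Rightarrow> 'u) category_data) mult_enat dim \<and>
           (\<forall>G \<in> Ob (Grp :: ('u monoid, 'u \<Rightarrow> 'u) category_data).
              dim (iso_class Grp G) = group_card G)) \<and>
         (\<exists>dim. monoid_valued_dimension (FinGrp :: ('u monoid, 'u \<Rightarrow> 'u) category_data) mult_nat dim \<and>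
           (\<forall>G \<in> Ob (FinGrp :: ('u monoid, 'u \<Rightarrow> 'u) category_data).
              dim (iso_class FinGrp G) = order G))"
proof (rule conjI)
  \<comment> \<open>Writing \<open>Grp\<close> as an update of itself brings it into the form of the
    general lemma.\<close>
  have Grp_eq: "(Grp :: ('u monoid, 'u \<Rightarrow> 'u) category_data) = Grp\<lparr>Ob := Collect group\<rparr>"
    by (simp add: Grp_def)
  have "\<exists>dim. monoid_valued_dimension (Grp\<lparr>Ob := Collect group\<rparr>) mult_enat dim \<and>
    (\<forall>G \<in> Collect group. dim (iso_class (Grp\<lparr>Ob := Collect group\<rparr>) (G :: 'u monoid)) = group_card G)"
    using assms
    by (rule monoid_valued_dimension_Grp_Ob_update)
      (auto simp: comm_monoid_mult_enat carrier_mult_enat group_card_mult bij_betw_same_card dest: bij_betw_finite intro: group_card_eq_of_bij_betw)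
  then show "\<exists>dim. monoid_valued_dimension (Grp :: ('u monoid, 'u \<Rightarrow> 'u) category_data) mult_enat dim \<and>
      (\<forall>G \<in> Ob (Grp :: ('u monoid, 'u \<Rightarrow> 'u) category_data). dim (iso_class Grp G) = group_card G)"
    by (simp flip: Grp_eq)
next
  have "\<exists>dim. monoid_valued_dimension FinGrp mult_nat dim \<and>
    (\<forall>G \<in> {G. group G \<and> finite (carrier G)}. dim (iso_class FinGrp (G :: 'u monoid)) = order G)"
    using assms unfolding FinGrp_def
  proof (rule monoid_valued_dimension_Grp_Ob_update)
    fix G A C :: "'u monoid" and e :: "'u \<times> 'u \<Rightarrow> 'u"
    assume "A \<in> {G. group G \<and> finite (carrier G)}" "C \<in> {G. group G \<and> finite (carrier G)}"
      "group G" "carrier G \<subseteq> e ` (carrier A \<times> carrier C)"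
    then show "G \<in> {G. group G \<and> finite (carrier G)}"
      \<comment> \<open>The carrier lies in the image of a finite product, so it is finite.\<close>
      by (simp add: finite_subset)
  next
    fix A B C P :: "'u monoid" and k
    assume "bij_betw k (carrier P \<times> carrier B) (carrier A \<times> carrier C)"
    from bij_betw_same_card[OF this] show "order P \<otimes>\<^bsub>mult_nat\<^esub> order B = order A \<otimes>\<^bsub>mult_nat\<^esub> order C"
      by (simp add: mult_nat_def order_def card_cartesian_product)
  next
    fix G H :: "'u monoid" and k
    assume "bij_betw k (carrier G) (carrier H)"
    then show "order G = order H"
      by (simp add: order_def bij_betw_same_card)
  qed (use comm_monoid_mult_nat in \<open>auto simp: mult_nat_def\<close>)
  then show "\<exists>dim. monoid_valued_dimension (FinGrp :: ('u monoid, 'u \<Rightarrow> 'u) category_data) mult_nat dim \<and>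
      (\<forall>G \<in> Ob (FinGrp :: ('u monoid, 'u \<Rightarrow> 'u) category_data). dim (iso_class FinGrp G) = order G)"
    by (simp add: FinGrp_def)
qed

end
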